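(* Let $a\ge2$ be an integer, $H=\langle a,a+1\rangle$, $k$ a field, $A=k[[H]]=k[[t^a,t^{a+1}]]\subseteq k[[t]]$, and $\mathfrak m=(t^a,t^{a+1})$ the maximal ideal of $A$. Let $0<s\in H$, let $q>0$ be an integer, and put $Q=(t^s)$ and $I=Q:\mathfrak m^q$. Then the following three conditions are equivalent: (1) $I\subseteq\overline Q$, where $\overline Q$ is the integral closure of the ideal $Q$ in $A$; (2) $\mathfrak m^qI=\mathfrak m^qQ$; (3) $q<a$.
   Context: $\langle a,a+1\rangle=\{\alpha a+\beta(a+1)\mid 0\le\alpha,\beta\in\mathbb Z\}$. $k[[t]]$ is the formal power series ring in an indeterminate $t$; $Q:\mathfrak m^q=\{x\in A\mid\mathfrak m^qx\subseteq Q\}$. *)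

theory Defs
  imports
    "HOL-Computational_Algebra.Formal_Power_Series"
    "HOL-Algebra.Ideal_Product"
begin

definition semigroup_gen :: "nat \<Rightarrow> nat set" where
  "semigroup_gen a = {\<alpha> * a + \<beta> * (a + 1) | \<alpha> \<beta>. True}"

text \<open>The ring \<open>k[[H]]\<close>: the subring of \<open>k[[t]]\<close> of the power series in which only
  exponents from \<open>H\<close> occur. It is a ring whenever \<open>H\<close> is a submonoid of the natural numbers.\<close>

definition semigroup_ring :: "nat set \<Rightarrow> 'k::field fps ring" where
  "semigroup_ring H =
    \<lparr> carrier = {f. \<forall>n. fps_nth f n \<noteq> 0 \<longrightarrow> n \<in> H},
      mult = (*), one = 1, zero = 0, add = (+) \<rparr>"

text \<open>\<open>ideals_set R\<close> is the monoid of ideals of \<open>R\<close> under the ideal product, with unit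
  \<open>carrier R\<close>; hence \<open>ideal_power R I n\<close> is \<open>I\<^sup>n\<close>, with \<open>I\<^sup>0 = R\<close>.\<close>

abbreviation ideal_power :: "('a, 'b) ring_scheme \<Rightarrow> 'a set \<Rightarrow> nat \<Rightarrow> 'a set" where
  "ideal_power R I n \<equiv> I [^]\<^bsub>ideals_set R\<^esub> n"

definition ideal_colon :: "('a, 'b) ring_scheme \<Rightarrow> 'a set \<Rightarrow> 'a set \<Rightarrow> 'a set" where
  "ideal_colon R I J = {x \<in> carrier R. \<forall>y\<in>J. y \<otimes>\<^bsub>R\<^esub> x \<in> I}"

text \<open>\<open>x\<close> is integral over \<open>I\<close> if \<open>x\<^sup>n + c\<^sub>1 x\<^sup>n\<^sup>-\<^sup>1 + \<dots> + c\<^sub>n = 0\<close> for some \<open>n \<ge> 1\<close> and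
  some coefficients \<open>c\<^sub>i \<in> I\<^sup>i\<close>.\<close>

definition ideal_integral_closure :: "('a, 'b) ring_scheme \<Rightarrow> 'a set \<Rightarrow> 'a set" where
  "ideal_integral_closure R I =
    {x \<in> carrier R. \<exists>n\<ge>1. \<exists>c :: nat \<Rightarrow> 'a.
       (\<forall>i\<in>{1..n}. c i \<in> ideal_power R I i) \<and>
       x [^]\<^bsub>R\<^esub> n \<oplus>\<^bsub>R\<^esub> (\<Oplus>\<^bsub>R\<^esub>i\<in>{1..n}. c i \<otimes>\<^bsub>R\<^esub> x [^]\<^bsub>R\<^esub> (n - i)) = \<zero>\<^bsub>R\<^esub>}"

lemma zero_in_semigroup_gen: "0 \<in> semigroup_gen a"
  unfolding semigroup_gen_def by force

lemma add_in_semigroup_gen: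
  assumes "m \<in> semigroup_gen a" "n \<in> semigroup_gen a"
  shows "m + n \<in> semigroup_gen a"
proof -
  obtain b c where m: "m = b * a + c * (a + 1)"
    using assms(1) by (auto simp: semigroup_gen_def)
  obtain d e where n: "n = d * a + e * (a + 1)"
    using assms(2) by (auto simp: semigroup_gen_def)
  have "m + n = (b + d) * a + (c + e) * (a + 1)"
    unfolding m n by (simp add: algebra_simps)
  then show ?thesis unfolding semigroup_gen_def by blast
qed

lemma gens_in_semigroup_gen: "a \<in> semigroup_gen a" "a + 1 \<in> semigroup_gen a"
proof -
  have "a = 1 * a + 0 * (a + 1)" "a + 1 = 0 * a + 1 * (a + 1)" by simp_all
  then show "a \<in> semigroup_gen a" "a + 1 \<in> semigroup_gen a"
    unfolding semigroup_gen_def by blast+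
qed

lemma semigroup_gen_pred:
  assumes "n \<in> semigroup_gen a" "n > 0"
  shows "(\<exists>m\<in>semigroup_gen a. n = m + a) \<or> (\<exists>m\<in>semigroup_gen a. n = m + (a + 1))"
proof -
  obtain b c where n: "n = b * a + c * (a + 1)"
    using assms(1) by (auto simp: semigroup_gen_def)
  show ?thesis
  proof (cases b)
    case (Suc b')
    then have "n = (b' * a + c * (a + 1)) + a" using n by simp
    then show ?thesis unfolding semigroup_gen_def by blast
  next
    case 0
    then obtain c' where "c = Suc c'" using n assms(2) by (cases c) auto
    then have "n = (0 * a + c' * (a + 1)) + (a + 1)" using n 0 by simp
    then show ?thesis unfolding semigroup_gen_def by blast
  qed
qed

lemma fps_X_power_in_semigroup_ring:
  "n \<in> H \<Longrightarrow> fps_X ^ n \<in> carrier (semigroup_ring H :: 'k::field fps ring)"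
  by (auto simp: semigroup_ring_def)

lemma cring_semigroup_ring: "cring (semigroup_ring (semigroup_gen a) :: 'k::field fps ring)"
proof (rule cringI)
  let ?R = "semigroup_ring (semigroup_gen a) :: 'k fps ring"
  show "abelian_group ?R"
  proof (rule abelian_groupI)
    fix x assume "x \<in> carrier ?R"
    then show "\<exists>y\<in>carrier ?R. y \<oplus>\<^bsub>?R\<^esub> x = \<zero>\<^bsub>?R\<^esub>"
      by (intro bexI[of _ "- x"]) (auto simp: semigroup_ring_def)
  next
    fix x y assume "x \<in> carrier ?R" "y \<in> carrier ?R"
    then show "x \<oplus>\<^bsub>?R\<^esub> y \<in> carrier ?R"
      unfolding semigroup_ring_def by simp (metis add.right_neutral)
  qed (auto simp: semigroup_ring_def)
  show "comm_monoid ?R"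
  proof (rule comm_monoidI)
    fix x y assume xy: "x \<in> carrier ?R" "y \<in> carrier ?R"
    have "n \<in> semigroup_gen a" if nz: "fps_nth (x * y) n \<noteq> 0" for n
    proof -
      obtain i where i: "i \<le> n" "fps_nth x i * fps_nth y (n - i) \<noteq> 0"
      proof (rule ccontr)
        assume "\<not> thesis"
        then have "\<forall>i\<in>{0..n}. fps_nth x i * fps_nth y (n - i) = 0" using that by force
        then have "fps_nth (x * y) n = 0" unfolding fps_mult_nth by (rule sum.neutral)
        then show False using nz by contradiction
      qed
      then have "i \<in> semigroup_gen a" "n - i \<in> semigroup_gen a"
        using xy by (auto simp: semigroup_ring_def)
      then show ?thesis using add_in_semigroup_gen i(1) by fastforce
    qed
    then show "x \<otimes>\<^bsub>?R\<^esub> y \<in> carrier ?R" by (simp add: semigroup_ring_def)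
  qed (auto simp: semigroup_ring_def zero_in_semigroup_gen)
qed (auto simp: semigroup_ring_def algebra_simps)

lemma maximalideal_gens:
  fixes a :: nat
  assumes "a > 0"
  defines "R \<equiv> semigroup_ring (semigroup_gen a) :: 'k::field fps ring"
  shows "maximalideal (Idl\<^bsub>R\<^esub> {fps_X ^ a, fps_X ^ (a + 1)}) R"
    and "Idl\<^bsub>R\<^esub> {fps_X ^ a, fps_X ^ (a + 1)} = {f \<in> carrier R. fps_nth f 0 = 0}"
proof -
  interpret cring R unfolding R_def by (rule cring_semigroup_ring)
  let ?G = "{fps_X ^ a, fps_X ^ (a + 1)} :: 'k fps set"
  let ?M = "{f \<in> carrier R. fps_nth f 0 = 0}"
  have ops: "x \<otimes>\<^bsub>R\<^esub> y = x * y" "x \<oplus>\<^bsub>R\<^esub> y = x + y" "\<one>\<^bsub>R\<^esub> = 1" "\<zero>\<^bsub>R\<^esub> = 0" for x y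
    by (simp_all add: R_def semigroup_ring_def)
  have carr: "f \<in> carrier R \<longleftrightarrow> (\<forall>n. fps_nth f n \<noteq> 0 \<longrightarrow> n \<in> semigroup_gen a)" for f
    by (simp add: R_def semigroup_ring_def)
  have G: "?G \<subseteq> carrier R"
    unfolding R_def using gens_in_semigroup_gen[of a] fps_X_power_in_semigroup_ring by blast
  have idM: "ideal ?M R"
  proof (rule idealI)
    show "subgroup ?M (add_monoid R)"
    proof (rule add.subgroupI)
      fix x assume x: "x \<in> ?M"
      have "x \<oplus>\<^bsub>R\<^esub> (- x) = \<zero>\<^bsub>R\<^esub>" "- x \<in> carrier R" using x by (auto simp: ops carr)
      then have "\<ominus>\<^bsub>R\<^esub> x = - x" using x by (metis (mono_tags, lifting) mem_Collect_eq a_comm minus_equality)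
      then show "\<ominus>\<^bsub>R\<^esub> x \<in> ?M"
        using x \<open>- x \<in> carrier R\<close> by simp
    next
      fix x y assume "x \<in> ?M" "y \<in> ?M"
      then have "x \<oplus>\<^bsub>R\<^esub> y \<in> carrier R" "fps_nth (x + y) 0 = 0" by auto
      then show "x \<oplus>\<^bsub>R\<^esub> y \<in> ?M" by (simp add: ops)
    next
      have "\<zero>\<^bsub>R\<^esub> \<in> ?M" by (simp add: ops carr)
      then show "?M \<noteq> {}" by blast
    qed auto
  next
    fix x y assume "x \<in> ?M" "y \<in> carrier R"
    then show "y \<otimes>\<^bsub>R\<^esub> x \<in> ?M" "x \<otimes>\<^bsub>R\<^esub> y \<in> ?M"
      using m_closed[of x y] m_closed[of y x] by (auto simp: ops)
  qed (rule ring_axioms)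
  have idG: "ideal (Idl\<^bsub>R\<^esub> ?G) R" using genideal_ideal[OF G] .
  show eq: "Idl\<^bsub>R\<^esub> ?G = ?M"
  proof
    show "Idl\<^bsub>R\<^esub> ?G \<subseteq> ?M"
      by (rule genideal_minimal[OF idM]) (use G assms(1) in auto)
    show "?M \<subseteq> Idl\<^bsub>R\<^esub> ?G"
    proof
      fix f assume f: "f \<in> ?M"
      let ?H = "semigroup_gen a"
      define g where "g = Abs_fps (\<lambda>n. if n \<in> ?H then fps_nth f (n + a) else 0)"
      define h where "h = Abs_fps (\<lambda>n. if n \<in> ?H \<and> n + 1 \<notin> ?H then fps_nth f (n + a + 1) else 0)"
      have gh: "g \<in> carrier R" "h \<in> carrier R"
        by (auto simp: carr g_def h_def split: if_splits)
      have "f = fps_X ^ a * g + fps_X ^ (a + 1) * h"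
      proof (rule fps_ext)
        fix n
        have g_nth: "(if n < a then 0 else fps_nth g (n - a)) =
            (if a \<le> n \<and> n - a \<in> ?H then fps_nth f n else 0)"
          by (simp add: g_def)
        have "Suc (n - Suc a) = n - a" "n - Suc a + a + 1 = n" if "a + 1 \<le> n"
          using that by simp_all
        then have h_nth: "(if n < a + 1 then 0 else fps_nth h (n - (a + 1))) =
            (if a + 1 \<le> n \<and> n - (a + 1) \<in> ?H \<and> n - a \<notin> ?H then fps_nth f n else 0)"
          by (auto simp: h_def)
        have R: "fps_nth (fps_X ^ a * g + fps_X ^ (a + 1) * h) n =
            (if a \<le> n \<and> n - a \<in> ?H then fps_nth f n else 0) +
            (if a + 1 \<le> n \<and> n - (a + 1) \<in> ?H \<and> n - a \<notin> ?H then fps_nth f n else 0)"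
          unfolding fps_add_nth fps_X_power_mult_nth g_nth h_nth ..
        consider "n = 0" | "n > 0" "fps_nth f n = 0" | "n \<in> ?H" "n > 0"
          using f by (auto simp: carr)
        then show "fps_nth f n = fps_nth (fps_X ^ a * g + fps_X ^ (a + 1) * h) n"
        proof cases
          case 1
          then show ?thesis unfolding R using f by auto
        next
          case 2
          then show ?thesis unfolding R by simp
        next
          case 3
          show ?thesis
          proof (cases "a \<le> n \<and> n - a \<in> ?H")
            case True
            then show ?thesis unfolding R by simp
          next
            case False
            then obtain m where "m \<in> ?H" "n = m + (a + 1)"
              using semigroup_gen_pred[OF 3] by auto
            then show ?thesis unfolding R using False by simp
          qed
        qed
      qed
      moreover have "fps_X ^ a \<otimes>\<^bsub>R\<^esub> g \<oplus>\<^bsub>R\<^esub> fps_X ^ (a + 1) \<otimes>\<^bsub>R\<^esub> h \<in> Idl\<^bsub>R\<^esub> ?G"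
      proof -
        have "?G \<subseteq> Idl\<^bsub>R\<^esub> ?G" using genideal_self[OF G] .
        then show ?thesis
          using idG gh by (intro additive_subgroup.a_closed[OF ideal.axioms(1)[OF idG]]
            ideal.I_r_closed[OF idG]) auto
      qed
      ultimately show "f \<in> Idl\<^bsub>R\<^esub> ?G" by (simp add: ops)
    qed
  qed
  show "maximalideal (Idl\<^bsub>R\<^esub> ?G) R"
    unfolding eq
  proof (rule maximalidealI[OF idM])
    have "\<one>\<^bsub>R\<^esub> \<in> carrier R" "\<one>\<^bsub>R\<^esub> \<notin> ?M" by (simp_all add: ops(3) carr zero_in_semigroup_gen) 
    then show "carrier R \<noteq> ?M" by blast
  next
    fix J assume J: "ideal J R" "?M \<subseteq> J" "J \<subseteq> carrier R"
    show "J = ?M \<or> J = carrier R"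
    proof (cases "J = ?M")
      case False
      then obtain f where f: "f \<in> J" "f \<in> carrier R" "fps_nth f 0 \<noteq> 0" using J by blast
      let ?c = "fps_nth f 0"
      have inv: "fps_const (inverse ?c) \<in> carrier R" by (simp add: carr zero_in_semigroup_gen)
      have "fps_const (inverse ?c) * f \<in> J"
        using ideal.I_l_closed[OF J(1) f(1) inv] by (simp add: ops)
      moreover have "1 - fps_const (inverse ?c) * f \<in> J"
      proof -
        have "1 - fps_const (inverse ?c) * f \<in> ?M"
          using f by (auto simp: carr zero_in_semigroup_gen split: if_splits)
        then show ?thesis using J by blast
      qed
      ultimately have "fps_const (inverse ?c) * f \<oplus>\<^bsub>R\<^esub> (1 - fps_const (inverse ?c) * f) \<in> J"
        using additive_subgroup.a_closed[OF ideal.axioms(1)[OF J(1)]] by blast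
      then have "\<one>\<^bsub>R\<^esub> \<in> J" by (simp add: ops)
      then show ?thesis using ideal.one_imp_carrier[OF J(1)] by blast
    qed simp
  qed
qed

text \<open>\<open>k[[H]] = k[[t\<^sup>a, t\<^sup>a\<^sup>+\<^sup>1]]\<close>: its elements are the series
  \<open>\<Sum>\<^sub>i\<^sub>,\<^sub>j c\<^sub>i\<^sub>j (t\<^sup>a)\<^sup>i (t\<^sup>a\<^sup>+\<^sup>1)\<^sup>j\<close>.\<close>

lemma carrier_semigroup_ring_eq:
  assumes "a > 0"
  shows "carrier (semigroup_ring (semigroup_gen a) :: 'k::field fps ring) =
    {Abs_fps (\<lambda>n. \<Sum>(i, j) | i * a + j * (a + 1) = n. c i j) | c. True}"
    (is "_ = ?S")
proof
  show "?S \<subseteq> carrier (semigroup_ring (semigroup_gen a) :: 'k fps ring)"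
  proof
    fix f :: "'k fps" assume "f \<in> ?S"
    then obtain c where f: "f = Abs_fps (\<lambda>n. \<Sum>(i, j) | i * a + j * (a + 1) = n. c i j)" by blast
    have "n \<in> semigroup_gen a" if "fps_nth f n \<noteq> 0" for n
    proof (rule ccontr)
      assume "n \<notin> semigroup_gen a"
      then have "{(i, j). i * a + j * (a + 1) = n} = {}" unfolding semigroup_gen_def by blast
      then show False using that unfolding f fps_nth_Abs_fps by (metis sum.empty)
    qed
    then show "f \<in> carrier (semigroup_ring (semigroup_gen a))" by (simp add: semigroup_ring_def)
  qed
  show "carrier (semigroup_ring (semigroup_gen a) :: 'k fps ring) \<subseteq> ?S"
  proof
    fix f :: "'k fps" assume f: "f \<in> carrier (semigroup_ring (semigroup_gen a))"
    have "\<exists>p. fst p * a + snd p * (a + 1) = n" if "n \<in> semigroup_gen a" for n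
      using that unfolding semigroup_gen_def by auto
    then obtain p where p: "\<And>n. n \<in> semigroup_gen a \<Longrightarrow> fst (p n) * a + snd (p n) * (a + 1) = n"
      by metis
    define c where "c = (\<lambda>i j. let n = i * a + j * (a + 1) in if p n = (i, j) then fps_nth f n else 0)"
    have "fps_nth f n = (\<Sum>(i, j) | i * a + j * (a + 1) = n. c i j)" for n
    proof -
      let ?T = "{(i, j). i * a + j * (a + 1) = n}"
      have "?T \<subseteq> {..n} \<times> {..n}"
      proof (rule subsetI)
        fix x assume "x \<in> ?T"
        then obtain i j where x: "x = (i, j)" "n = i * a + (j + j * a)" by auto
        moreover have "i \<le> i * a" using assms by simp
        ultimately have "i \<le> n" "j \<le> n" by linarith+
        then show "x \<in> {..n} \<times> {..n}" using x by simp
      qed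
      then have fin: "finite ?T" by (rule finite_subset) simp
      have "(\<Sum>(i, j)\<in>?T. c i j) = (\<Sum>x\<in>?T. if x = p n then fps_nth f n else 0)"
        by (rule sum.cong) (auto simp: c_def Let_def dest: sym split: prod.splits)
      also have "\<dots> = (if p n \<in> ?T then fps_nth f n else 0)" using fin by (simp add: sum.delta)
      also have "\<dots> = fps_nth f n"
        using p[of n] f by (auto simp: semigroup_ring_def case_prod_beta)
      finally show ?thesis by simp
    qed
    then have "f = Abs_fps (\<lambda>n. \<Sum>(i, j) | i * a + j * (a + 1) = n. c i j)"
      by (intro fps_ext) simp
    then show "f \<in> ?S" by blast
  qed
qed

end

theory Submission
  imports Defs
begin

text \<open>
  With \<open>n = k a + r\<close>, \<open>r < a\<close>, one has \<open>n \<in> H\<close> iff \<open>r \<le> k\<close>. Hence \<open>\<mm>\<^sup>q\<close> consists of the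
  elements of \<open>A\<close> of order at least \<open>q a\<close>, and \<open>Q\<close> has as integral closure the elements of
  order at least \<open>s\<close>.

  If \<open>q < a\<close> and \<open>x \<in> I\<close> had order \<open>v < s\<close>, then multiplying \<open>x\<close> by \<open>t\<^sup>q\<^sup>a, \<dots>, t\<^sup>q\<^sup>a\<^sup>+\<^sup>q\<close> would
  produce \<open>q + 1\<close> consecutive elements of \<open>H\<close> starting below \<open>q a\<close>, but the runs of \<open>H\<close> there
  have at most \<open>q\<close> elements. So \<open>I\<close> has order at least \<open>s\<close>, and \<open>\<mm>\<^sup>q I \<subseteq> Q\<close> then gives
  \<open>\<mm>\<^sup>q I \<subseteq> t\<^sup>s \<mm>\<^sup>q\<close>.
  If \<open>q \<ge> a\<close>, some \<open>n \<in> H\<close> satisfies \<open>s - a \<le> n < s\<close>, and \<open>t\<^sup>n \<in> I\<close> because all integers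
  from \<open>a (a - 1)\<close> on lie in \<open>H\<close>; this \<open>t\<^sup>n\<close> violates both (1) and (2).
\<close>

section \<open>Order of power series, and arithmetic of the semigroup \<open>H\<close>\<close>

lemma fps_X_power_dvd_iff:
  "fps_X ^ n dvd (f :: 'k::field fps) \<longleftrightarrow> (\<forall>i<n. fps_nth f i = 0)"
proof
  assume "fps_X ^ n dvd f"
  then show "\<forall>i<n. fps_nth f i = 0" by (auto simp: fps_X_power_mult_nth elim!: dvdE)
next
  assume "\<forall>i<n. fps_nth f i = 0"
  then have "f = fps_X ^ n * fps_shift n f"
    by (intro fps_ext) (auto simp: fps_X_power_mult_nth)
  then show "fps_X ^ n dvd f" by (rule dvdI)
qed

text \<open>Regroup \<open>b * a + c * (a + 1)\<close> as \<open>(b + c) * a + c\<close>: reducing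
  \<open>c\<close> modulo \<open>a\<close> only raises the quotient. Conversely, quotient k and
  remainder r with r \<le> k give the coefficients k - r and r.\<close>

lemma semigroup_gen_iff:
  assumes "a > 0"
  shows "n \<in> semigroup_gen a \<longleftrightarrow> n mod a \<le> n div a"
proof
  assume "n \<in> semigroup_gen a"
  then obtain b c where n: "n = b * a + c * (a + 1)" by (auto simp: semigroup_gen_def)
  then have "n = c + (b + c) * a" by (simp add: algebra_simps)
  then have "n mod a = c mod a" "n div a = b + c + c div a"
    using assms by simp_all
  then show "n mod a \<le> n div a" using mod_less_eq_dividend[of c a] by linarith
next
  assume le: "n mod a \<le> n div a"
  have "n = (n div a) * a + n mod a" by simp
  also have "\<dots> = (n div a - n mod a) * a + (n mod a) * (a + 1)"
    using le by (simp add: diff_mult_distrib mult_le_mono1)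
  finally show "n \<in> semigroup_gen a" unfolding semigroup_gen_def by blast
qed

text \<open>From this bound on, the quotient by \<open>a\<close> is at least \<open>a - 1\<close>,
  the largest possible remainder.\<close>

lemma semigroup_gen_conductor:
  assumes "a > 0" "n \<ge> a * (a - 1)"
  shows "n \<in> semigroup_gen a"
proof -
  have "a - 1 \<le> n div a" using div_le_mono[OF assms(2), of a] assms(1) by simp
  moreover have "n mod a < a" using assms(1) by simp
  ultimately have "n mod a \<le> n div a" by linarith
  then show ?thesis using assms(1) by (simp add: semigroup_gen_iff)
qed

lemma mult_in_semigroup_gen: "n * a \<in> semigroup_gen a"
  unfolding semigroup_gen_def by (force intro: exI[of _ n] exI[of _ 0])

text \<open>In the block of integers with quotient k < q, the elements of \<open>H\<close> are those
  with remainder at most k. Since k + 1 < a, remainder k + 1 is a gap, reached after at most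
  \<open>q\<close> steps unless \<open>m\<close> is already a gap.\<close>

lemma semigroup_gen_no_long_run:
  assumes "q < a" "m < q * a"
  shows "\<exists>i\<le>q. m + i \<notin> semigroup_gen a"
proof -
  define k where "k = m div a"
  define r where "r = m mod a"
  have m: "m = k * a + r" and r: "r < a" using assms by (auto simp: k_def r_def)
  have k: "k < q" unfolding k_def using assms by (simp add: less_mult_imp_div_less)
  show ?thesis
  proof (cases "r \<le> k")
    case True
    let ?i = "k + 1 - r"
    have "m + ?i = (k + 1) + k * a" using True m by simp
    moreover have "k + 1 < a" using k assms by simp
    ultimately have "(m + ?i) div a = k" "(m + ?i) mod a = k + 1"
      by (simp_all only: div_mult_self1 mod_mult_self1 div_less mod_less add_0)
    then have "m + ?i \<notin> semigroup_gen a" using assms by (simp add: semigroup_gen_iff)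
    then show ?thesis using k by (intro exI[of _ ?i]) auto
  next
    case False
    then have "m + 0 \<notin> semigroup_gen a" using assms by (simp add: semigroup_gen_iff k_def r_def)
    then show ?thesis by blast
  qed
qed

text \<open>The largest multiple of \<open>a\<close> below \<open>s\<close> serves, as all multiples
  of \<open>a\<close> lie in \<open>H\<close>.\<close>

lemma semigroup_gen_below:
  assumes "a > 0" "s \<in> semigroup_gen a" "s > 0"
  shows "\<exists>n\<in>semigroup_gen a. n < s \<and> s \<le> n + a"
proof (cases "s mod a = 0")
  case True
  then obtain k where k: "s = a * k" by auto
  then have "k > 0" using assms by (cases k) auto
  then have "s = (k - 1) * a + a" using k by (cases k) auto
  then show ?thesis using mult_in_semigroup_gen[of "k - 1" a] assms(1)
    by (intro bexI[of _ "(k - 1) * a"]) auto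
next
  case False
  have s: "s = s div a * a + s mod a" by simp
  moreover have "s mod a < a" using assms(1) by simp
  ultimately have "s div a * a < s" "s \<le> s div a * a + a" using False by linarith+
  then show ?thesis using mult_in_semigroup_gen by blast
qed

section \<open>The ring \<open>A\<close>, its order filtration, and the powers of the maximal
  ideal\<close>

lemma ideal_power_0: "ideal_power R J 0 = carrier R"
  unfolding nat_pow_def ideals_set_def by simp

lemma ideal_power_Suc: "ideal_power R J (Suc n) = ideal_power R J n \<cdot>\<^bsub>R\<^esub> J"
  unfolding nat_pow_def ideals_set_def by simp

locale consecutive_semigroup_ring =
  fixes a :: nat and A :: "'k::field fps ring"
  assumes a_pos: "a > 0"
    and A_eq: "A = semigroup_ring (semigroup_gen a)"
begin

sublocale cring A
  unfolding A_eq by (rule cring_semigroup_ring)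

lemma A_simps [simp]:
  "x \<otimes>\<^bsub>A\<^esub> y = x * y" "x \<oplus>\<^bsub>A\<^esub> y = x + y" "\<one>\<^bsub>A\<^esub> = 1" "\<zero>\<^bsub>A\<^esub> = 0"
  by (simp_all add: A_eq semigroup_ring_def)

lemma A_carrier: "f \<in> carrier A \<longleftrightarrow> (\<forall>n. fps_nth f n \<noteq> 0 \<longrightarrow> n \<in> semigroup_gen a)"
  by (simp add: A_eq semigroup_ring_def)

lemma A_pow [simp]: "x [^]\<^bsub>A\<^esub> (n::nat) = x ^ n"
  by (induction n) simp_all

lemma A_mult: "x \<in> carrier A \<Longrightarrow> y \<in> carrier A \<Longrightarrow> x * y \<in> carrier A"
  using m_closed by simp

lemma A_add: "x \<in> carrier A \<Longrightarrow> y \<in> carrier A \<Longrightarrow> x + y \<in> carrier A"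
  using a_closed by simp

lemma A_power: "x \<in> carrier A \<Longrightarrow> x ^ n \<in> carrier A"
  using nat_pow_closed[of x n] by simp

lemma A_finsum:
  assumes "finite S" "\<And>i. i \<in> S \<Longrightarrow> f i \<in> carrier A"
  shows "(\<Oplus>\<^bsub>A\<^esub>i\<in>S. f i) = sum f S"
  using assms by (induction S rule: finite_induct) (simp_all add: Pi_def)

lemma A_X_power: "n \<in> semigroup_gen a \<Longrightarrow> fps_X ^ n \<in> carrier A"
  unfolding A_eq by (rule fps_X_power_in_semigroup_ring)

lemma A_const: "fps_const c \<in> carrier A"
  by (simp add: A_carrier zero_in_semigroup_gen)

lemma A_uminus: "x \<in> carrier A \<Longrightarrow> - x \<in> carrier A"
  by (simp add: A_carrier)

lemma A_conductor: "fps_X ^ (a * (a - 1)) dvd f \<Longrightarrow> f \<in> carrier A"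
  unfolding A_carrier fps_X_power_dvd_iff
  using semigroup_gen_conductor[OF a_pos] not_le by blast

text \<open>Divisibility is meant in all of k[[t]], so the cofactor need not lie in
  \<open>A\<close>: this is a condition on the order alone.\<close>

definition filt :: "nat \<Rightarrow> 'k fps set" where
  "filt N = {f \<in> carrier A. fps_X ^ N dvd f}"

lemma filt_add: "x \<in> filt N \<Longrightarrow> y \<in> filt N \<Longrightarrow> x + y \<in> filt N"
  by (simp add: filt_def A_add)

lemma filt_mult: "x \<in> filt M \<Longrightarrow> y \<in> filt N \<Longrightarrow> x * y \<in> filt (M + N)"
  by (simp add: filt_def A_mult power_add mult_dvd_mono)

lemma ideal_prod_subset_filt:
  assumes "I \<subseteq> filt M" "J \<subseteq> filt N"
  shows "I \<cdot>\<^bsub>A\<^esub> J \<subseteq> filt (M + N)"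
proof
  fix x assume "x \<in> I \<cdot>\<^bsub>A\<^esub> J"
  then show "x \<in> filt (M + N)"
    by induction (use assms in \<open>auto intro: filt_add filt_mult\<close>)
qed

text \<open>No element of \<open>H\<close> lies strictly between 0 and \<open>a\<close>, so a zero
  constant term already forces order at least \<open>a\<close>.\<close>

lemma max_ideal_eq_filt: "Idl\<^bsub>A\<^esub> {fps_X ^ a, fps_X ^ (a + 1)} = filt a"
proof -
  have "fps_nth f 0 = 0 \<longleftrightarrow> fps_X ^ a dvd f" if "f \<in> carrier A" for f
  proof
    assume f0: "fps_nth f 0 = 0"
    have "fps_nth f i = 0" if "i < a" for i
    proof (rule ccontr)
      assume "fps_nth f i \<noteq> 0"
      then have "i \<in> semigroup_gen a" "i \<noteq> 0"
        using \<open>f \<in> carrier A\<close> f0 by (auto simp: A_carrier intro: ccontr)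
      then show False using \<open>i < a\<close> a_pos by (simp add: semigroup_gen_iff)
    qed
    then show "fps_X ^ a dvd f" by (simp add: fps_X_power_dvd_iff)
  qed (use a_pos in \<open>simp add: fps_X_power_dvd_iff\<close>)
  then show ?thesis
    using maximalideal_gens(2)[OF a_pos, where 'k = 'k] by (auto simp: A_eq[symmetric] filt_def)
qed

text \<open>Every positive exponent in \<open>H\<close> is m + a or m + a + 1 with m in
  \<open>H\<close>. The series \<open>g\<close> collects the terms of the first kind,
  \<open>h\<close> those of the second kind only. This is the induction step for the powers of the
  maximal ideal.\<close>

lemma filt_decompose:
  assumes f: "f \<in> filt (n * a + a)"
  shows "\<exists>g\<in>filt (n * a). \<exists>h\<in>filt (n * a). f = g * fps_X ^ a + h * fps_X ^ (a + 1)"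
proof -
  let ?H = "semigroup_gen a"
  define g where "g = Abs_fps (\<lambda>n. if n \<in> ?H then fps_nth f (n + a) else 0)"
  define h where "h = Abs_fps (\<lambda>n. if n \<in> ?H \<and> n + 1 \<notin> ?H then fps_nth f (n + a + 1) else 0)"
  have fA: "f \<in> carrier A" and f0: "\<And>i. i < n * a + a \<Longrightarrow> fps_nth f i = 0"
    using f by (auto simp: filt_def fps_X_power_dvd_iff)
  have g: "g \<in> filt (n * a)"
    using f0 by (auto simp: filt_def A_carrier fps_X_power_dvd_iff g_def)
  \<comment> \<open>At i = n a - 1 the relevant coefficient of \<open>f\<close> has index n a + a
    and may be nonzero; there \<open>h\<close> vanishes because i + 1 lies in
    \<open>H\<close>.\<close>
  have "fps_nth h i = 0" if "i < n * a" for i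
  proof (cases "i + 1 = n * a")
    case True
    then show ?thesis using mult_in_semigroup_gen[of n a] by (simp add: h_def)
  next
    case False
    then have "i + a + 1 < n * a + a" using that by linarith
    then show ?thesis using f0 by (simp add: h_def)
  qed
  then have h: "h \<in> filt (n * a)"
    by (auto simp: filt_def A_carrier fps_X_power_dvd_iff h_def)
  have "fps_nth f i = fps_nth (g * fps_X ^ a + h * fps_X ^ (a + 1)) i" for i
  proof -
    have g_nth: "fps_nth (g * fps_X ^ a) i = (if a \<le> i \<and> i - a \<in> ?H then fps_nth f i else 0)"
      by (auto simp: g_def fps_X_power_mult_right_nth)
    have "Suc (i - Suc a) = i - a" "i - Suc a + a + 1 = i" if "a + 1 \<le> i"
      using that by simp_all
    then have h_nth: "fps_nth (h * fps_X ^ (a + 1)) i =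
        (if a + 1 \<le> i \<and> i - (a + 1) \<in> ?H \<and> i - a \<notin> ?H then fps_nth f i else 0)"
      unfolding fps_X_power_mult_right_nth by (auto simp: h_def)
    show ?thesis
    proof (cases "fps_nth f i = 0")
      case True
      then show ?thesis unfolding fps_add_nth g_nth h_nth by simp
    next
      case False
      then have "i \<in> ?H" "i > 0" using fA f0[of i] a_pos by (auto simp: A_carrier intro!: Nat.gr0I)
      from semigroup_gen_pred[OF this] show ?thesis
        unfolding fps_add_nth g_nth h_nth by auto
    qed
  qed
  then have "f = g * fps_X ^ a + h * fps_X ^ (a + 1)" by (rule fps_ext)
  then show ?thesis using g h by blast
qed

lemma max_ideal_power_eq_filt: "ideal_power A (filt a) n = filt (n * a)"
proof (induction n)
  case 0
  then show ?case unfolding ideal_power_0 by (auto simp: filt_def)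
next
  case (Suc n)
  have "filt (n * a) \<cdot>\<^bsub>A\<^esub> filt a = filt (n * a + a)"
  proof
    show "filt (n * a) \<cdot>\<^bsub>A\<^esub> filt a \<subseteq> filt (n * a + a)"
      by (rule ideal_prod_subset_filt) auto
    show "filt (n * a + a) \<subseteq> filt (n * a) \<cdot>\<^bsub>A\<^esub> filt a"
    proof
      fix f assume "f \<in> filt (n * a + a)"
      then obtain g h where gh: "g \<in> filt (n * a)" "h \<in> filt (n * a)"
        and f: "f = g * fps_X ^ a + h * fps_X ^ (a + 1)"
        using filt_decompose by blast
      have "fps_X ^ a \<in> filt a" "fps_X ^ (a + 1) \<in> filt a"
        using gens_in_semigroup_gen[of a, THEN A_X_power] by (simp_all add: filt_def)
      then have "g \<otimes>\<^bsub>A\<^esub> fps_X ^ a \<oplus>\<^bsub>A\<^esub> h \<otimes>\<^bsub>A\<^esub> fps_X ^ (a + 1) \<in> filt (n * a) \<cdot>\<^bsub>A\<^esub> filt a"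
        using gh by (intro ideal_prod.sum ideal_prod.prod)
      then show "f \<in> filt (n * a) \<cdot>\<^bsub>A\<^esub> filt a" by (simp add: f)
    qed
  qed
  then show ?case by (simp only: ideal_power_Suc Suc mult_Suc add.commute)
qed

section \<open>The principal ideal of \<open>fps_X ^ s\<close>, its powers and its integral
  closure\<close>

lemma principal_ideal_eq:
  assumes "s \<in> semigroup_gen a"
  shows "Idl\<^bsub>A\<^esub> {fps_X ^ s} = {f * fps_X ^ s | f. f \<in> carrier A}"
  using cgenideal_eq_genideal[OF A_X_power[OF assms]] by (auto simp: cgenideal_def)

lemma principal_ideal_subset_filt:
  assumes "s \<in> semigroup_gen a"
  shows "Idl\<^bsub>A\<^esub> {fps_X ^ s} \<subseteq> filt s"
  unfolding principal_ideal_eq[OF assms] filt_def using A_X_power[OF assms] A_mult by auto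

lemma principal_ideal_power:
  assumes "s \<in> semigroup_gen a" "f \<in> carrier A"
  shows "f * fps_X ^ (n * s) \<in> ideal_power A (Idl\<^bsub>A\<^esub> {fps_X ^ s}) n"
proof (induction n)
  case 0
  then show ?case unfolding ideal_power_0 using assms by simp
next
  case (Suc n)
  have "fps_X ^ s \<in> Idl\<^bsub>A\<^esub> {fps_X ^ s}"
    using genideal_self'[OF A_X_power[OF assms(1)]] .
  with Suc have "(f * fps_X ^ (n * s)) \<otimes>\<^bsub>A\<^esub> fps_X ^ s \<in> ideal_power A (Idl\<^bsub>A\<^esub> {fps_X ^ s}) (Suc n)"
    unfolding ideal_power_Suc by (rule ideal_prod.prod)
  then show ?case by (simp add: power_add mult_ac)
qed

lemma principal_ideal_power_subset_filt:
  assumes "s \<in> semigroup_gen a"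
  shows "ideal_power A (Idl\<^bsub>A\<^esub> {fps_X ^ s}) n \<subseteq> filt (n * s)"
proof (induction n)
  case 0
  then show ?case unfolding ideal_power_0 by (auto simp: filt_def)
next
  case (Suc n)
  from ideal_prod_subset_filt[OF Suc principal_ideal_subset_filt[OF assms]] show ?case
    unfolding ideal_power_Suc by (simp add: add.commute)
qed

text \<open>If \<open>x\<close> had order v < s, each term \<open>c i * x ^ (n - i)\<close> with i
  \<ge> 1 would have order at least i s + (n - i) v > n v, so the terms could not cancel
  \<open>x ^ n\<close>, whose order is exactly n v.\<close>

lemma integral_imp_order_ge:
  assumes s: "s \<in> semigroup_gen a"
    and x: "x \<in> ideal_integral_closure A (Idl\<^bsub>A\<^esub> {fps_X ^ s})"
  shows "fps_X ^ s dvd x"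
proof (rule ccontr)
  assume ndvd: "\<not> fps_X ^ s dvd x"
  define v where "v = subdegree x"
  have x0: "x \<noteq> 0" using ndvd by auto
  have v: "v < s"
  proof (rule ccontr)
    assume "\<not> v < s"
    then have "\<forall>i<s. fps_nth x i = 0" by (auto simp: v_def intro: nth_less_subdegree_zero)
    then show False using ndvd by (simp add: fps_X_power_dvd_iff)
  qed
  obtain u where u: "x = u * fps_X ^ v"
    using subdegree_decompose[of x] unfolding v_def by blast
  have u0: "fps_nth u 0 \<noteq> 0"
    using nth_subdegree_nonzero[OF x0] unfolding v_def[symmetric]
    by (simp add: u fps_X_power_mult_right_nth)
  have xA: "x \<in> carrier A" using x by (simp add: ideal_integral_closure_def)
  obtain n c where cQ: "\<forall>i\<in>{1..n}. c i \<in> ideal_power A (Idl\<^bsub>A\<^esub> {fps_X ^ s}) i"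
    and eq: "x ^ n + (\<Oplus>\<^bsub>A\<^esub>i\<in>{1..n}. c i * x ^ (n - i)) = 0"
    using x unfolding ideal_integral_closure_def by (simp only: A_simps A_pow) blast
  have c: "c i \<in> filt (i * s)" if "i \<in> {1..n}" for i
    using cQ principal_ideal_power_subset_filt[OF s] that by blast
  have "(\<Oplus>\<^bsub>A\<^esub>i\<in>{1..n}. c i * x ^ (n - i)) = (\<Sum>i\<in>{1..n}. c i * x ^ (n - i))"
    using c xA by (intro A_finsum) (auto simp: filt_def A_mult A_power)
  moreover have "fps_X ^ (n * v + 1) dvd c i * x ^ (n - i)" if i: "i \<in> {1..n}" for i
  proof -
    have "i * (v + 1) \<le> i * s" using v by (intro mult_le_mono2) simp
    moreover have "i \<ge> 1" "n * v = i * v + (n - i) * v"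
      using i by (auto simp flip: add_mult_distrib)
    ultimately have "n * v + 1 \<le> i * s + v * (n - i)" by (simp add: mult.commute)
    then have "fps_X ^ (n * v + 1) dvd (fps_X ^ (i * s + v * (n - i)) :: 'k fps)"
      by (rule le_imp_power_dvd)
    moreover have "fps_X ^ (i * s) dvd c i" using c[OF i] by (simp add: filt_def)
    then have "fps_X ^ (i * s + v * (n - i)) dvd c i * x ^ (n - i)"
      unfolding power_add by (rule mult_dvd_mono) (simp add: u power_mult_distrib power_mult)
    ultimately show ?thesis by (rule dvd_trans)
  qed
  ultimately have "fps_X ^ (n * v + 1) dvd (\<Oplus>\<^bsub>A\<^esub>i\<in>{1..n}. c i * x ^ (n - i))"
    by (metis (no_types, lifting) dvd_sum)
  moreover have "x ^ n = - (\<Oplus>\<^bsub>A\<^esub>i\<in>{1..n}. c i * x ^ (n - i))"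
    using eq by (simp add: eq_neg_iff_add_eq_0)
  ultimately have "fps_X ^ (n * v + 1) dvd x ^ n" by simp
  then have "fps_nth (x ^ n) (n * v) = 0" unfolding fps_X_power_dvd_iff by simp
  moreover have "x ^ n = u ^ n * fps_X ^ (n * v)"
    by (simp add: u power_mult_distrib mult.commute[of n] power_mult)
  ultimately have "fps_nth (u ^ n) 0 = 0" by (simp add: fps_X_power_mult_right_nth)
  then show False using u0 by simp
qed

text \<open>For \<open>x = t\<^sup>s g\<close> with \<open>g = c + h\<close>, \<open>h(0) = 0\<close>, and \<open>C\<close> large enough that all series of order
  \<open>C\<close> lie in \<open>A\<close>, the integral equation is \<open>(x - c t\<^sup>s)\<^sup>C = t\<^sup>s\<^sup>C h\<^sup>C\<close>.\<close>

lemma order_ge_imp_integral: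
  assumes s: "s \<in> semigroup_gen a" and x: "x \<in> filt s"
  shows "x \<in> ideal_integral_closure A (Idl\<^bsub>A\<^esub> {fps_X ^ s})"
proof -
  let ?T = "fps_X ^ s :: 'k fps"
  let ?Q = "Idl\<^bsub>A\<^esub> {?T}"
  \<comment> \<open>The series \<open>h\<close> below need not lie in \<open>A\<close>, but its
    \<open>C\<close>-th power does, having order at least \<open>C\<close>. \<open>Suc\<close> keeps
    the degree of the equation positive even for a = 1.\<close>
  define C where "C = Suc (a * (a - 1))"
  obtain g where g: "x = ?T * g" using x by (auto simp: filt_def)
  define c where "c = fps_const (fps_nth g 0)"
  define h where "h = g - c"
  have "fps_X ^ 1 dvd h" unfolding fps_X_power_dvd_iff by (simp add: h_def c_def)
  then have "fps_X ^ C dvd h ^ C" by (simp add: dvd_power_same)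
  then have "fps_X ^ (a * (a - 1)) dvd h ^ C"
    by (rule dvd_trans[rotated]) (simp add: C_def)
  then have hA: "h ^ C \<in> carrier A" by (rule A_conductor)
  have xA: "x \<in> carrier A" using x by (simp add: filt_def)
  \<comment> \<open>These are the binomial coefficients of (x - c T)^C with T = t^s, stripped of
    T^i; the right-hand side T^C h^C is absorbed into the last one.\<close>
  define b where "b i = fps_const (of_nat (C choose i)) * (- c) ^ i - (if i = C then h ^ C else 0)" for i
  define d where "d i = b i * fps_X ^ (i * s)" for i
  have bA: "b i \<in> carrier A" for i
  proof -
    have "fps_const (of_nat (C choose i)) * (- c) ^ i \<in> carrier A"
      unfolding c_def by (intro A_mult A_power A_uminus A_const)
    moreover have "- (if i = C then h ^ C else 0) \<in> carrier A"
      using hA zero_closed by (intro A_uminus) (simp split: if_splits)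
    ultimately show ?thesis unfolding b_def diff_conv_add_uminus by (rule A_add)
  qed
  have dQ: "d i \<in> ideal_power A ?Q i" for i
    unfolding d_def by (rule principal_ideal_power[OF s bA])
  have dA: "d i \<in> carrier A" for i
    using dQ[of i] principal_ideal_power_subset_filt[OF s] by (auto simp: filt_def)
  let ?e = "\<lambda>i. of_nat (C choose i) * (- c * ?T) ^ i * x ^ (C - i)"
  have de: "d i * x ^ (C - i) = ?e i - (if i = C then (?T * h) ^ C else 0)" for i
  proof -
    have T: "fps_X ^ (i * s) = ?T ^ i" by (simp add: power_mult[symmetric] mult.commute)
    show ?thesis
    proof (cases "i = C")
      case True
      have "d C = of_nat (C choose C) * (- c) ^ C * ?T ^ C - h ^ C * ?T ^ C"
        unfolding d_def b_def T[unfolded True] by (simp add: left_diff_distrib)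
      then show ?thesis unfolding True by (simp add: power_mult_distrib[symmetric] mult.commute)
    next
      case False
      have "d i = of_nat (C choose i) * (- c) ^ i * ?T ^ i"
        unfolding d_def b_def T using False by (simp add: fps_of_nat)
      then show ?thesis unfolding power_mult_distrib using False by (simp add: mult.assoc)
    qed
  qed
  have "(\<Oplus>\<^bsub>A\<^esub>i\<in>{1..C}. d i * x ^ (C - i)) = (\<Sum>i\<in>{1..C}. d i * x ^ (C - i))"
    by (rule A_finsum) (auto intro!: A_mult A_power dA xA)
  also have "\<dots> = (\<Sum>i\<in>{1..C}. ?e i) - (\<Sum>i\<in>{1..C}. if i = C then (?T * h) ^ C else 0)"
    unfolding de sum_subtractf ..
  also have "(\<Sum>i\<in>{1..C}. if i = C then (?T * h) ^ C else 0) = (?T * h) ^ C"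
    by (simp add: C_def)
  also have "?T * h = - c * ?T + x" by (simp add: h_def g algebra_simps)
  also have "(- c * ?T + x) ^ C = (\<Sum>i\<le>C. ?e i)" by (rule binomial_ring)
  also have "\<dots> = x ^ C + (\<Sum>i\<in>{1..C}. ?e i)"
    unfolding atMost_atLeast0 by (simp add: sum.atLeast_Suc_atMost)
  finally have "x ^ C + (\<Oplus>\<^bsub>A\<^esub>i\<in>{1..C}. d i * x ^ (C - i)) = 0" by simp
  then show ?thesis
    unfolding ideal_integral_closure_def using xA dQ
    by (auto intro!: exI[of _ C] exI[of _ d] simp: C_def)
qed

lemma integral_closure_eq_filt:
  assumes "s \<in> semigroup_gen a"
  shows "ideal_integral_closure A (Idl\<^bsub>A\<^esub> {fps_X ^ s}) = filt s"
  using integral_imp_order_ge[OF assms] order_ge_imp_integral[OF assms]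
  by (auto simp: filt_def ideal_integral_closure_def)

section \<open>The colon ideal and its product with a power of the maximal ideal\<close>

text \<open>Any nonzero coefficient at some v < s leads to the contradiction, not only the lowest:
  multiplying by a monomial just shifts it, and division by t^s must land in
  \<open>H\<close>.\<close>

lemma colon_subset_filt:
  assumes s: "s \<in> semigroup_gen a" and q: "q < a"
  shows "ideal_colon A (Idl\<^bsub>A\<^esub> {fps_X ^ s}) (filt (q * a)) \<subseteq> filt s"
proof
  fix x assume x: "x \<in> ideal_colon A (Idl\<^bsub>A\<^esub> {fps_X ^ s}) (filt (q * a))"
  have "fps_nth x v = 0" if v: "v < s" for v
  proof (rule ccontr)
    assume nz: "fps_nth x v \<noteq> 0"
    have run: "s \<le> q * a + i + v \<and> q * a + i + v - s \<in> semigroup_gen a" if "i \<le> q" for i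
    proof -
      have "q * a + i \<in> semigroup_gen a"
        using that a_pos q by (simp add: semigroup_gen_iff)
      then have "fps_X ^ (q * a + i) \<in> filt (q * a)"
        by (simp add: filt_def A_X_power le_imp_power_dvd)
      then obtain z where z: "z \<in> carrier A" and eq: "fps_X ^ (q * a + i) * x = z * fps_X ^ s"
        using x by (auto simp: ideal_colon_def principal_ideal_eq[OF s])
      have "fps_nth (z * fps_X ^ s) (q * a + i + v) \<noteq> 0"
        unfolding eq[symmetric] using nz by (simp add: fps_X_power_mult_nth)
      then show ?thesis using z by (auto simp: A_carrier fps_X_power_mult_right_nth split: if_splits)
    qed
    \<comment> \<open>This makes the truncated subtraction of \<open>s\<close> exact, so that the
      exponents really are consecutive.\<close>
    have "s \<le> q * a + v" using run[of 0] by simp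
    then have "q * a + v - s < q * a" "\<And>i. q * a + i + v - s = q * a + v - s + i"
      using v by auto
    then show False using semigroup_gen_no_long_run[OF q, of "q * a + v - s"] run by auto
  qed
  then show "x \<in> filt s" using x by (auto simp: filt_def fps_X_power_dvd_iff ideal_colon_def)
qed

text \<open>For \<open>y\<close> of order at least q a \<ge> a^2, the product with t^n has order at
  least a (a - 1) + s. Its quotient by t^s is past the conductor bound, hence in
  \<open>A\<close>.\<close>

lemma X_power_in_colon:
  assumes s: "s \<in> semigroup_gen a" and q: "a \<le> q"
    and n: "n \<in> semigroup_gen a" "s \<le> n + a"
  shows "fps_X ^ n \<in> ideal_colon A (Idl\<^bsub>A\<^esub> {fps_X ^ s}) (filt (q * a))"
proof -
  have "y * fps_X ^ n \<in> Idl\<^bsub>A\<^esub> {fps_X ^ s}" if "y \<in> filt (q * a)" for y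
  proof -
    have "a * a \<le> q * a" using q by simp
    moreover have "a * (a - 1) + a = a * a" using a_pos by (cases a) simp_all
    ultimately have "a * (a - 1) + s \<le> q * a + n" using n(2) by linarith
    then have "fps_X ^ (a * (a - 1) + s) dvd (fps_X ^ (q * a + n) :: 'k fps)"
      by (rule le_imp_power_dvd)
    also have "\<dots> dvd y * fps_X ^ n"
      using that unfolding power_add by (intro mult_dvd_mono) (simp_all add: filt_def)
    finally obtain w where "y * fps_X ^ n = fps_X ^ (a * (a - 1) + s) * w" ..
    then have "y * fps_X ^ n = (fps_X ^ (a * (a - 1)) * w) * fps_X ^ s"
      by (simp add: power_add mult_ac)
    moreover have "fps_X ^ (a * (a - 1)) * w \<in> carrier A" by (rule A_conductor) simp
    ultimately show ?thesis unfolding principal_ideal_eq[OF s] by blast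
  qed
  then show ?thesis by (simp add: ideal_colon_def A_X_power[OF n(1)])
qed

text \<open>A product y x with \<open>x\<close> in the colon ideal equals z t^s with
  \<open>z\<close> in \<open>A\<close>; as \<open>x\<close> has order at least \<open>s\<close>,
  cancelling t^s leaves \<open>z\<close> in \<open>filt N\<close>. The other inclusion holds because
  the principal ideal lies in its colon ideal.\<close>

lemma filt_prod_colon_eq:
  assumes s: "s \<in> semigroup_gen a"
    and sub: "ideal_colon A (Idl\<^bsub>A\<^esub> {fps_X ^ s}) (filt N) \<subseteq> filt s" (is "?I \<subseteq> _")
  shows "filt N \<cdot>\<^bsub>A\<^esub> ?I = filt N \<cdot>\<^bsub>A\<^esub> (Idl\<^bsub>A\<^esub> {fps_X ^ s})" (is "_ = _ \<cdot>\<^bsub>A\<^esub> ?Q")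
proof
  have Q: "?Q = {f * fps_X ^ s | f. f \<in> carrier A}" by (rule principal_ideal_eq[OF s])
  have "?Q \<subseteq> ?I"
  proof (rule subsetI)
    fix x assume "x \<in> ?Q"
    then obtain f where f: "x = f * fps_X ^ s" "f \<in> carrier A" by (auto simp: Q)
    then have "y * x \<in> ?Q" if "y \<in> filt N" for y
      using that unfolding Q by (auto simp: filt_def mult.assoc intro!: exI[of _ "y * f"] A_mult)
    then show "x \<in> ?I" using f by (simp add: ideal_colon_def A_mult A_X_power s)
  qed
  show "filt N \<cdot>\<^bsub>A\<^esub> ?Q \<subseteq> filt N \<cdot>\<^bsub>A\<^esub> ?I"
  proof
    fix w assume "w \<in> filt N \<cdot>\<^bsub>A\<^esub> ?Q"
    then show "w \<in> filt N \<cdot>\<^bsub>A\<^esub> ?I"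
    proof induction
      case (prod y x)
      then show ?case using \<open>?Q \<subseteq> ?I\<close> by (blast intro: ideal_prod.prod)
    qed (rule ideal_prod.sum)
  qed
  show "filt N \<cdot>\<^bsub>A\<^esub> ?I \<subseteq> filt N \<cdot>\<^bsub>A\<^esub> ?Q"
  proof
    fix w assume "w \<in> filt N \<cdot>\<^bsub>A\<^esub> ?I"
    then show "w \<in> filt N \<cdot>\<^bsub>A\<^esub> ?Q"
    proof induction
      case (prod y x)
      then obtain z where z: "z \<in> carrier A" "y * x = z * fps_X ^ s"
        by (auto simp: ideal_colon_def Q)
      have "y * x \<in> filt (N + s)" using prod sub by (auto intro: filt_mult)
      then have "fps_X ^ N * fps_X ^ s dvd z * fps_X ^ s"
        by (simp add: filt_def z(2) power_add)
      then have "z \<in> filt N" using z(1) by (simp add: filt_def)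
      moreover have "fps_X ^ s \<in> ?Q" using genideal_self'[OF A_X_power[OF s]] .
      ultimately have "z \<otimes>\<^bsub>A\<^esub> fps_X ^ s \<in> filt N \<cdot>\<^bsub>A\<^esub> ?Q" by (rule ideal_prod.prod)
      then show ?case by (simp add: z(2))
    qed (rule ideal_prod.sum)
  qed
qed

lemma X_power_prod_notin:
  assumes s: "s \<in> semigroup_gen a" and n: "n < s"
  shows "fps_X ^ N * fps_X ^ n \<notin> filt N \<cdot>\<^bsub>A\<^esub> (Idl\<^bsub>A\<^esub> {fps_X ^ s})"
proof
  assume "fps_X ^ N * fps_X ^ n \<in> filt N \<cdot>\<^bsub>A\<^esub> (Idl\<^bsub>A\<^esub> {fps_X ^ s})"
  then have "fps_X ^ (N + s) dvd (fps_X ^ (N + n) :: 'k fps)"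
    using ideal_prod_subset_filt[OF order_refl principal_ideal_subset_filt[OF s], of N] by (fastforce simp: filt_def power_add)
  then have "fps_nth (fps_X ^ (N + n) :: 'k fps) (N + n) = 0"
    using n unfolding fps_X_power_dvd_iff by (meson add_strict_left_mono)
  then show False by (simp add: fps_X_power_nth)
qed

end

section \<open>The equivalence of the three conditions\<close>

theorem theorem3p3:
  fixes a s q :: nat
    and A :: "'k::field fps ring"
  assumes "a \<ge> 2"
  defines "H \<equiv> semigroup_gen a"
  defines "A \<equiv> semigroup_ring H"
  defines "\<mm> \<equiv> Idl\<^bsub>A\<^esub> {fps_X ^ a, fps_X ^ (a + 1)}"
  assumes "0 < s" and "s \<in> H" and "q > 0"
  defines "Q \<equiv> Idl\<^bsub>A\<^esub> {fps_X ^ s}"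
  defines "I \<equiv> ideal_colon A Q (ideal_power A \<mm> q)"
  shows "(I \<subseteq> ideal_integral_closure A Q
            \<longleftrightarrow> ideal_power A \<mm> q \<cdot>\<^bsub>A\<^esub> I = ideal_power A \<mm> q \<cdot>\<^bsub>A\<^esub> Q)
       \<and> (ideal_power A \<mm> q \<cdot>\<^bsub>A\<^esub> I = ideal_power A \<mm> q \<cdot>\<^bsub>A\<^esub> Q \<longleftrightarrow> q < a)"
proof -
  interpret consecutive_semigroup_ring a A
    using assms by unfold_locales auto
  have s: "s \<in> semigroup_gen a" using \<open>s \<in> H\<close> by (simp add: H_def)
  have mq: "ideal_power A \<mm> q = filt (q * a)"
    unfolding \<mm>_def max_ideal_eq_filt by (rule max_ideal_power_eq_filt)
  have I: "I = ideal_colon A (Idl\<^bsub>A\<^esub> {fps_X ^ s}) (filt (q * a))"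
    by (simp add: I_def mq Q_def)
  have closure: "ideal_integral_closure A Q = filt s"
    unfolding Q_def by (rule integral_closure_eq_filt[OF s])
  show ?thesis
  \<comment> \<open>For q < a all three conditions are shown to hold, otherwise all three to fail;
    both equivalences follow.\<close>
  proof (cases "q < a")
    case True
    have "I \<subseteq> filt s" unfolding I by (rule colon_subset_filt[OF s True])
    moreover have "filt (q * a) \<cdot>\<^bsub>A\<^esub> I = filt (q * a) \<cdot>\<^bsub>A\<^esub> Q"
      unfolding I Q_def by (rule filt_prod_colon_eq[OF s colon_subset_filt[OF s True]])
    ultimately show ?thesis using True by (simp add: mq closure)
  next
    case False
    obtain n where n: "n \<in> semigroup_gen a" "n < s" "s \<le> n + a"
      using semigroup_gen_below[OF a_pos s \<open>0 < s\<close>] by blast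
    have nI: "fps_X ^ n \<in> I"
      unfolding I using False by (intro X_power_in_colon s n) simp
    have "fps_X ^ n \<notin> filt s"
      using n(2) by (auto simp: filt_def fps_X_power_dvd_iff fps_X_power_nth)
    moreover have "fps_X ^ (q * a) \<in> filt (q * a)"
      by (simp add: filt_def A_X_power mult_in_semigroup_gen)
    then have "fps_X ^ (q * a) \<otimes>\<^bsub>A\<^esub> fps_X ^ n \<in> filt (q * a) \<cdot>\<^bsub>A\<^esub> I"
      using nI by (rule ideal_prod.prod)
    then have "filt (q * a) \<cdot>\<^bsub>A\<^esub> I \<noteq> filt (q * a) \<cdot>\<^bsub>A\<^esub> Q"
      using X_power_prod_notin[OF s n(2), of "q * a"] by (auto simp: Q_def)
    ultimately show ?thesis using False nI by (auto simp: mq closure)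
  qed
qed

end
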